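(* Let $\mathcal{A}\in\mathbb{C}^{I_1\times\cdots\times I_N\times J_1\times\cdots\times J_N}$ and $\mathcal{B}\in\mathbb{C}^{J_1\times\cdots\times J_N\times I_1\times\cdots\times I_N}$. Then $(\mathcal{A}*_N\mathcal{B})^{\dagger}=\mathcal{B}^{\dagger}*_N\mathcal{A}^{\dagger}$ if and only if both $\mathcal{A}^{\dagger}*_N\mathcal{A}*_N\mathcal{B}*_N\mathcal{B}^*$ and $\mathcal{A}^**_N\mathcal{A}*_N\mathcal{B}*_N\mathcal{B}^{\dagger}$ are Hermitian.
   Context: Tensors are complex multiway arrays, with entries of $\mathcal{A}\in\mathbb{C}^{I_1\times\cdots\times I_N\times J_1\times\cdots\times J_N}$ denoted $a_{i_1\ldots i_N j_1\ldots j_N}$. The Einstein product of $\mathcal{A}\in\mathbb{C}^{I_1\times\cdots\times I_N\times K_1\times\cdots\times K_N}$ and $\mathcal{B}\in\mathbb{C}^{K_1\times\cdots\times K_N\times J_1\times\cdots\times J_M}$ is the tensor $\mathcal{A}*_N\mathcal{B}\in\mathbb{C}^{I_1\times\cdots\times I_N\times J_1\times\cdots\times J_M}$ with $(\mathcal{A}*_N\mathcal{B})_{i_1\ldots i_N j_1\ldots j_M}=\sum_{k_1\ldots k_N}a_{i_1\ldots i_N k_1\ldots k_N}b_{k_1\ldots k_N j_1\ldots j_M}$; it is associative. The conjugate transpose $\mathcal{A}^*\in\mathbb{C}^{J_1\times\cdots\times J_N\times I_1\times\cdots\times I_N}$ has entries $(\mathcal{A}^* )_{j_1\ldots j_N i_1\ldots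 i_N}=\overline{a_{i_1\ldots i_N j_1\ldots j_N}}$. A tensor $\mathcal{C}\in\mathbb{C}^{J_1\times\cdots\times J_N\times J_1\times\cdots\times J_N}$ is Hermitian if $\mathcal{C}=\mathcal{C}^*$. The Moore-Penrose inverse $\mathcal{A}^{\dagger}$ of $\mathcal{A}\in\mathbb{C}^{I_1\times\cdots\times I_N\times J_1\times\cdots\times J_N}$ is the unique tensor $\mathcal{X}\in\mathbb{C}^{J_1\times\cdots\times J_N\times I_1\times\cdots\times I_N}$ (it always exists) satisfying (1) $\mathcal{A}*_N\mathcal{X}*_N\mathcal{A}=\mathcal{A}$; (2) $\mathcal{X}*_N\mathcal{A}*_N\mathcal{X}=\mathcal{X}$; (3) $(\mathcal{A}*_N\mathcal{X})^*=\mathcal{A}*_N\mathcal{X}$; (4) $(\mathcal{X}*_N\mathcal{A})^*=\mathcal{X}*_N\mathcal{A}$. *)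

theory Defs
  imports Complex_Main
begin

text \<open>
  Entries are indexed from 0: the multi-indices of shape \<open>[d\<^sub>1, \<dots>, d\<^sub>n]\<close> are the lists
  \<open>[i\<^sub>1, \<dots>, i\<^sub>n]\<close> with \<open>i\<^sub>k < d\<^sub>k\<close> for all \<open>k\<close>.
\<close>

definition multi_indices :: "nat list \<Rightarrow> nat list set" where
  "multi_indices ds = {is. list_all2 (<) is ds}"

text \<open>
  A tensor carries its list of dimensions. Entries outside the index range are fixed to 0, so that
  equality of tensors means same shape and same entries.
\<close>

typedef tensor =
  "{(ds :: nat list, f :: nat list \<Rightarrow> complex). \<forall>is. is \<notin> multi_indices ds \<longrightarrow> f is = 0}"
  by (rule exI[of _ "([], \<lambda>_. 0)"]) simp

setup_lifting type_definition_tensor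

lift_definition dims :: "tensor \<Rightarrow> nat list" is fst .

lift_definition entry :: "tensor \<Rightarrow> nat list \<Rightarrow> complex" is snd .

lift_definition mk_tensor :: "nat list \<Rightarrow> (nat list \<Rightarrow> complex) \<Rightarrow> tensor" is
  "\<lambda>ds f. (ds, \<lambda>is. if is \<in> multi_indices ds then f is else 0)"
  by simp

definition tensors :: "nat list \<Rightarrow> tensor set" where
  "tensors ds = {A. dims A = ds}"

text \<open>
  The product contracts the last \<open>N\<close> indices of \<open>A\<close> with the first \<open>N\<close> indices of \<open>B\<close>. It is
  meaningful only if the corresponding dimensions agree.
\<close>

definition einstein_prod :: "tensor \<Rightarrow> nat \<Rightarrow> tensor \<Rightarrow> tensor"
    ("(_ \<star>\<^bsub>_\<^esub> _)" [70, 0, 71] 70) where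
  "A \<star>\<^bsub>N\<^esub> B =
    (let m = length (dims A) - N in
      mk_tensor (take m (dims A) @ drop N (dims B))
        (\<lambda>is. \<Sum>k \<in> multi_indices (drop m (dims A)).
                entry A (take m is @ k) * entry B (k @ drop m is)))"

text \<open>
  In the next definitions \<open>N\<close> says where the index list of a tensor of shape
  \<open>I\<^sub>1 \<times> \<dots> \<times> I\<^sub>N \<times> J\<^sub>1 \<times> \<dots> \<times> J\<^sub>N\<close> is split into its two blocks.
\<close>

definition conj_transpose :: "nat \<Rightarrow> tensor \<Rightarrow> tensor" where
  "conj_transpose N A =
    (let m = length (dims A) - N in
      mk_tensor (drop N (dims A) @ take N (dims A))
        (\<lambda>is. cnj (entry A (drop m is @ take m is))))"

definition hermitian :: "nat \<Rightarrow> tensor \<Rightarrow> bool" where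
  "hermitian N C \<longleftrightarrow> C = conj_transpose N C"

definition is_mp_inverse :: "nat \<Rightarrow> tensor \<Rightarrow> tensor \<Rightarrow> bool" where
  "is_mp_inverse N A X \<longleftrightarrow>
    X \<in> tensors (drop N (dims A) @ take N (dims A)) \<and>
    A \<star>\<^bsub>N\<^esub> X \<star>\<^bsub>N\<^esub> A = A \<and>
    X \<star>\<^bsub>N\<^esub> A \<star>\<^bsub>N\<^esub> X = X \<and>
    conj_transpose N (A \<star>\<^bsub>N\<^esub> X) = A \<star>\<^bsub>N\<^esub> X \<and>
    conj_transpose N (X \<star>\<^bsub>N\<^esub> A) = X \<star>\<^bsub>N\<^esub> A"

definition mp_inverse :: "nat \<Rightarrow> tensor \<Rightarrow> tensor" where
  "mp_inverse N A = (THE X. is_mp_inverse N A X)"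

lemma tensor_eqI:
  assumes "dims A = dims B" and "\<And>is. is \<in> multi_indices (dims A) \<Longrightarrow> entry A is = entry B is"
  shows "A = B"
  using assms by transfer (auto simp: fun_eq_iff, metis)

lemma dims_mk_tensor [simp]: "dims (mk_tensor ds f) = ds"
  by transfer simp

lemma entry_mk_tensor [simp]:
  "entry (mk_tensor ds f) is = (if is \<in> multi_indices ds then f is else 0)"
  by transfer simp

lemma append_in_multi_indices:
  "i \<in> multi_indices Is \<Longrightarrow> j \<in> multi_indices Js \<Longrightarrow> i @ j \<in> multi_indices (Is @ Js)"
  by (auto simp: multi_indices_def intro: list_all2_appendI)

lemma einstein_prod_in_tensors:
  assumes "A \<in> tensors (Is @ Ks)" "B \<in> tensors (Ks @ Js)" "length Ks = N"
  shows "A \<star>\<^bsub>N\<^esub> B \<in> tensors (Is @ Js)"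
  using assms by (auto simp: tensors_def einstein_prod_def Let_def)

lemma entry_einstein_prod:
  assumes "A \<in> tensors (Is @ Ks)" "B \<in> tensors (Ks @ Js)" "length Ks = N"
    and "i \<in> multi_indices Is" "j \<in> multi_indices Js"
  shows "entry (A \<star>\<^bsub>N\<^esub> B) (i @ j) =
    (\<Sum>k \<in> multi_indices Ks. entry A (i @ k) * entry B (k @ j))"
proof -
  have "length i = length Is"
    using assms(4) by (auto simp: multi_indices_def dest: list_all2_lengthD)
  then show ?thesis
    using assms append_in_multi_indices[OF assms(4,5)]
    by (auto simp: tensors_def einstein_prod_def Let_def)
qed

lemma conj_transpose_in_tensors:
  assumes "A \<in> tensors (Is @ Js)" "length Is = N"
  shows "conj_transpose N A \<in> tensors (Js @ Is)"
  using assms by (auto simp: tensors_def conj_transpose_def Let_def)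

lemma entry_conj_transpose:
  assumes "A \<in> tensors (Is @ Js)" "length Is = N"
    and "i \<in> multi_indices Is" "j \<in> multi_indices Js"
  shows "entry (conj_transpose N A) (j @ i) = cnj (entry A (i @ j))"
proof -
  have "length j = length Js"
    using assms(4) by (auto simp: multi_indices_def dest: list_all2_lengthD)
  then show ?thesis
    using assms append_in_multi_indices[OF assms(4,3)]
    by (auto simp: tensors_def conj_transpose_def Let_def)
qed

end

theory Submission
  imports Defs
begin

text \<open>
  Splitting the multi-index of a tensor of shape \<open>I\<^sub>1 \<times> \<dots> \<times> I\<^sub>N \<times> J\<^sub>1 \<times> \<dots> \<times> J\<^sub>N\<close> into its two blocks
  turns it into a complex matrix whose rows and columns are indexed by multi-indices
  (\<open>matricize\<close>). The Einstein product becomes the matrix product and the conjugate transpose the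
  adjoint, so the theorem is the tensor form of Greville's reverse order law for matrices. To
  have one total product for tensors of all shapes, the matrices are taken inside the ring of all
  finitely supported complex matrices over a fixed index type. The algebra rests on one property
  of its involution: it is proper, that is, \<open>x\<^sup>* x = 0\<close> forces \<open>x = 0\<close>.

  Greville's law (\<open>reverse_order_law\<close>) is about the self-adjoint idempotents \<open>p = a\<^sup>\<dagger> a\<close> and
  \<open>q = b b\<^sup>\<dagger>\<close>. The first condition says that \<open>p\<close> commutes with \<open>b b\<^sup>*\<close>, the second that \<open>q\<close>
  commutes with \<open>a\<^sup>* a\<close>. If they hold, then \<open>p\<close> commutes with \<open>q\<close>, because \<open>q\<close> is the projection
  onto the range of \<open>b b\<^sup>*\<close>; this gives the two equations \<open>m x m = m\<close> and \<open>x m x = x\<close> for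
  \<open>m = a b\<close> and \<open>x = b\<^sup>\<dagger> a\<^sup>\<dagger>\<close>. Moreover \<open>x m = b\<^sup>\<dagger> p b\<close> and \<open>m x = a q a\<^sup>\<dagger>\<close> are self-adjoint by
  the first and the second condition, respectively. Conversely, if \<open>x\<close> is the pseudoinverse of
  \<open>m\<close>, then \<open>m\<^sup>* = x m m\<^sup>*\<close> makes \<open>w = b b\<^sup>* a\<^sup>*\<close> satisfy \<open>w\<^sup>* w = w\<^sup>* p w\<close>, so that properness
  gives \<open>w = p w\<close>, which is the first condition. Passing to adjoints exchanges the roles of
  \<open>a\<close> and \<open>b\<^sup>*\<close> and of the two conditions, which halves the work.

  The Moore-Penrose inverse is defined by a description operator, so its existence has to be
  proved as well. Orthogonal projection onto the column space of a matrix, obtained by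
  Gram-Schmidt induction, solves the normal equations \<open>a\<^sup>* a x = a\<^sup>*\<close> and, for \<open>a\<^sup>*\<close> in place of
  \<open>a\<close>, \<open>a a\<^sup>* z = a\<close>; then \<open>z\<^sup>* a x\<close> is the pseudoinverse of \<open>a\<close>.
\<close>


section \<open>Pseudoinverses in proper involutive rings\<close>

class proper_star_ring = ring +
  fixes adj :: "'a \<Rightarrow> 'a"
  assumes adj_adj [simp]: "adj (adj x) = x"
    and adj_add: "adj (x + y) = adj x + adj y"
    and adj_mult: "adj (x * y) = adj y * adj x"
    and adj_proper: "adj x * x = 0 \<Longrightarrow> x = 0"
begin

lemma adj_diff: "adj (x - y) = adj x - adj y"
  using adj_add[of "x - y" y] by (simp add: algebra_simps)

definition is_pseudoinverse :: "'a \<Rightarrow> 'a \<Rightarrow> bool" where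
  "is_pseudoinverse a x \<longleftrightarrow>
    a * x * a = a \<and> x * a * x = x \<and> adj (a * x) = a * x \<and> adj (x * a) = x * a"

lemma is_pseudoinverseD:
  assumes "is_pseudoinverse a x"
  shows "a * x * a = a" "x * a * x = x" "adj (a * x) = a * x" "adj (x * a) = x * a"
  using assms by (auto simp: is_pseudoinverse_def)

lemma is_pseudoinverse_unique:
  assumes x: "is_pseudoinverse a x" and y: "is_pseudoinverse a y"
  shows "x = y"
proof -
  note X = is_pseudoinverseD[OF x] and Y = is_pseudoinverseD[OF y]
  have "a * x = adj ((a * y) * (a * x))"
    using X(3) Y(1) by (simp add: mult.assoc[symmetric])
  also have "\<dots> = (a * x * a) * y"
    by (simp only: adj_mult[of "a * y"] X(3) Y(3)) (simp only: mult.assoc)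
  finally have ax: "a * x = a * y" using X(1) by simp
  have "x * a = adj ((x * a) * (y * a))"
    using X(4) Y(1) by (simp add: mult.assoc)
  also have "\<dots> = y * (a * x * a)"
    by (simp only: adj_mult[of "x * a"] X(4) Y(4)) (simp only: mult.assoc)
  finally have xa: "x * a = y * a" using X(1) by simp
  have "x = x * (a * x)" using X(2) by (simp only: mult.assoc)
  also have "\<dots> = y * a * y" by (simp only: ax xa mult.assoc[symmetric])
  finally show ?thesis using Y(2) by simp
qed

lemma is_pseudoinverse_adj:
  assumes "is_pseudoinverse a x"
  shows "is_pseudoinverse (adj a) (adj x)"
proof -
  note A = is_pseudoinverseD[OF assms]
  have "adj a * adj x * adj a = adj (a * x * a)" "adj x * adj a * adj x = adj (x * a * x)"
    by (simp_all add: adj_mult mult.assoc)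
  moreover have "adj a * adj x = x * a" "adj x * adj a = a * x"
    using A(3,4) by (simp_all add: adj_mult)
  ultimately show ?thesis
    using A by (simp add: is_pseudoinverse_def)
qed

text \<open>
  A solution \<open>x\<close> of \<open>a\<^sup>* a x = a\<^sup>*\<close> satisfies \<open>a x a = a\<close> and makes \<open>a x\<close> self-adjoint; applied
  to \<open>a\<^sup>*\<close>, the same fact yields an inner inverse \<open>z\<^sup>*\<close> of \<open>a\<close> for which \<open>z\<^sup>* a\<close> is self-adjoint.
  In \<open>z\<^sup>* a x\<close> both symmetries survive, since multiplying by \<open>a\<close> on one side absorbs the factor
  of the other kind.
\<close>

lemma is_pseudoinverse_of_normal_equations:
  assumes x: "adj a * a * x = adj a" and z: "a * adj a * z = a"
  shows "is_pseudoinverse a (adj z * a * x)"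
proof -
  \<comment> \<open>The local facts are stated for every solution of a normal equation because they are used
    both for \<open>a\<close> and for its adjoint.\<close>
  have ax: "adj (a * x) = a * x" if "adj a * a * x = adj a" for a x
  proof -
    have "adj (a * x) = adj x * (adj a * a * x)" using that by (simp add: adj_mult)
    also have "\<dots> = adj (a * x) * (a * x)" by (simp add: adj_mult mult.assoc)
    finally have e: "adj (a * x) = adj (a * x) * (a * x)" .
    from arg_cong[OF this, of adj] have "a * x = adj (a * x) * (a * x)"
      by (simp only: adj_mult[of "adj (a * x)"] adj_adj)
    with e show ?thesis by simp
  qed
  have axa: "a * x * a = a" if "adj a * a * x = adj a" for a x
  proof -
    have "adj a * (a * x * a) = adj a * a" using that by (simp add: mult.assoc[symmetric])
    then have "adj (a * x * a - a) * (a * x * a - a) = 0"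
      using that
      by (simp add: adj_diff adj_mult right_diff_distrib left_diff_distrib mult.assoc)
    from adj_proper[OF this] show ?thesis by simp
  qed
  have z': "adj (adj a) * adj a * z = adj (adj a)" using z by simp
  have za: "adj z * a = adj a * z" using ax[OF z'] by (simp add: adj_mult)
  have aza: "a * (adj z * a) = a"
    using arg_cong[OF axa[OF z'], of adj] by (simp add: adj_mult mult.assoc)
  have ay: "a * (adj z * a * x) = a * x" using aza by (simp add: mult.assoc[symmetric])
  have ya: "adj z * a * x * a = adj z * a" using axa[OF x] by (simp add: mult.assoc)
  show ?thesis
    unfolding is_pseudoinverse_def ay ya
  proof (intro conjI)
    show "a * x * a = a" using axa[OF x] .
    show "adj z * a * (adj z * a * x) = adj z * a * x"
      using ay by (simp add: mult.assoc)
    show "adj (a * x) = a * x" using ax[OF x] .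
    show "adj (adj z * a) = adj z * a" using za by (simp add: adj_mult)
  qed
qed


section \<open>The reverse order law\<close>

text \<open>
  The hypothesis says that \<open>p = a\<^sup>\<dagger> a\<close> commutes with \<open>b b\<^sup>*\<close>, hence \<open>p\<close> maps the range of \<open>b b\<^sup>*\<close>,
  which is the range of \<open>q = b b\<^sup>\<dagger>\<close>, into itself: \<open>q p q = p q\<close>. The left-hand side is
  self-adjoint, so the right-hand side is too.
\<close>

lemma projections_commute_of_selfadjoint:
  assumes a: "is_pseudoinverse a a'" and b: "is_pseudoinverse b b'"
    and herm: "adj (a' * a * b * adj b) = a' * a * b * adj b"
  shows "a' * a * (b * b') = b * b' * (a' * a)"
proof -
  note A = is_pseudoinverseD[OF a] and B = is_pseudoinverseD[OF b]
  define p where "p = a' * a"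
  define q where "q = b * b'"
  have p: "adj p = p" and q: "adj q = q" using A(4) B(3) by (simp_all add: p_def q_def)
  have qb: "q * b = b" using B(1) by (simp add: q_def)
  have bbq: "b * adj b * adj b' = b"
    using B(1,4) by (simp add: adj_mult[symmetric] mult.assoc)
  have h: "p * b * adj b = b * adj b * p"
    using herm p by (simp add: p_def[symmetric] adj_mult mult.assoc)
  have "q * (p * b * adj b) = p * b * adj b"
    unfolding h using qb by (simp add: mult.assoc[symmetric])
  then have "q * p * (b * adj b * adj b') = p * (b * adj b * adj b')"
    by (simp add: mult.assoc[symmetric])
  then have qpq: "q * p * q = p * q"
    unfolding bbq q_def by (simp add: mult.assoc[symmetric])
  have "p * q = adj (q * p * q)" by (simp add: adj_mult p q mult.assoc[symmetric]) (simp add: qpq)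
  also have "\<dots> = q * p" unfolding qpq by (simp add: adj_mult p q)
  finally have "p * q = q * p" .
  then show ?thesis by (simp add: p_def q_def)
qed

text \<open>
  Since \<open>b = b b\<^sup>* (b\<^sup>\<dagger>)\<^sup>*\<close> and \<open>b\<^sup>\<dagger> b b\<^sup>* = b\<^sup>*\<close>, moving \<open>p = a\<^sup>\<dagger> a\<close> across \<open>b b\<^sup>*\<close> turns \<open>b\<^sup>\<dagger> p b\<close>
  into \<open>b\<^sup>* p (b\<^sup>\<dagger>)\<^sup>*\<close>, its own adjoint.
\<close>

lemma product_selfadjoint_of_selfadjoint:
  assumes a: "is_pseudoinverse a a'" and b: "is_pseudoinverse b b'"
    and herm: "adj (a' * a * b * adj b) = a' * a * b * adj b"
  shows "adj (b' * (a' * a) * b) = b' * (a' * a) * b"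
proof -
  note A = is_pseudoinverseD[OF a] and B = is_pseudoinverseD[OF b]
  define p where "p = a' * a"
  have p: "adj p = p" using A(4) by (simp add: p_def)
  have bbb: "b * adj b * adj b' = b" and bbb': "b' * b * adj b = adj b"
    using B(1,4) arg_cong[OF B(1), of adj]
    by (simp_all add: adj_mult[symmetric] mult.assoc, metis B(4) adj_mult mult.assoc)
  have h: "p * b * adj b = b * adj b * p"
    using herm p by (simp add: p_def[symmetric] adj_mult mult.assoc)
  have "b' * p * b = b' * (p * b * adj b) * adj b'"
    using arg_cong[OF bbb, of "\<lambda>t. b' * p * t"] by (simp add: mult.assoc)
  also have "\<dots> = (b' * b * adj b) * p * adj b'" unfolding h by (simp add: mult.assoc)
  also have "\<dots> = adj (b' * p * b)" unfolding bbb' by (simp add: adj_mult p mult.assoc)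
  finally show ?thesis by (simp add: p_def)
qed

text \<open>
  With \<open>m = a b\<close> and \<open>p = a\<^sup>\<dagger> a\<close>, the assumption gives \<open>m\<^sup>* = b\<^sup>\<dagger> a\<^sup>\<dagger> m m\<^sup>*\<close>. Multiplied on the
  left by \<open>a b b\<^sup>* b\<close>, it becomes \<open>w\<^sup>* w = w\<^sup>* p w\<close> for \<open>w = b b\<^sup>* a\<^sup>*\<close>. As \<open>p\<close> is a projection,
  this says \<open>(w - p w)\<^sup>* (w - p w) = 0\<close>, so \<open>w = p w\<close>. Multiplying on the right by \<open>(a\<^sup>\<dagger>)\<^sup>*\<close> yields
  \<open>b b\<^sup>* p = p b b\<^sup>* p\<close>, whose right-hand side is self-adjoint.
\<close>

lemma selfadjoint_of_reverse_order:
  assumes a: "is_pseudoinverse a a'" and b: "is_pseudoinverse b b'"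
    and ab: "is_pseudoinverse (a * b) (b' * a')"
  shows "adj (a' * a * b * adj b) = a' * a * b * adj b"
proof -
  note A = is_pseudoinverseD[OF a] and B = is_pseudoinverseD[OF b]
    and M = is_pseudoinverseD[OF ab]
  define p where "p = a' * a"
  define w where "w = b * adj b * adj a"
  have p: "adj p = p" and pp: "p * p = p"
    using A by (simp_all add: p_def mult.assoc[symmetric])
  have ww: "adj w = a * b * adj b" by (simp add: w_def adj_mult mult.assoc)
  have bb: "adj b * b * b' = adj b"
    using arg_cong[OF B(1), of adj]
    by (simp only: adj_mult[of "b * b'"] B(3) mult.assoc[symmetric])
  have "adj (a * b) = adj (a * b * (b' * a' * (a * b)))" using M(1) by (simp add: mult.assoc)
  also have "\<dots> = b' * a' * (a * b) * adj (a * b)" by (simp only: adj_mult[of "a * b"] M(4))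
  finally have m: "adj b * adj a = b' * p * b * adj b * adj a"
    by (simp add: adj_mult p_def mult.assoc)
  have "adj w * w = a * b * adj b * b * (adj b * adj a)"
    unfolding ww by (simp add: w_def mult.assoc)
  also have "\<dots> = a * b * (adj b * b * b') * p * b * adj b * adj a"
    by (subst m) (simp only: mult.assoc)
  also have "\<dots> = adj w * (p * w)" unfolding bb ww by (simp add: w_def mult.assoc)
  finally have key: "adj w * w = adj w * (p * w)" .
  have "adj (w - p * w) * (w - p * w) = 0"
    using key arg_cong[OF pp, of "\<lambda>t. adj w * t * w"]
    by (simp add: adj_diff adj_mult p algebra_simps)
  from adj_proper[OF this] have wp: "w = p * w" by simp
  have "adj a * adj a' = p" using p by (simp add: p_def adj_mult)
  then have "b * adj b * p = w * adj a'" by (simp add: w_def mult.assoc)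
  also have "\<dots> = p * (w * adj a')" by (subst wp) (simp only: mult.assoc)
  also have "w * adj a' = b * adj b * p"
    using \<open>b * adj b * p = w * adj a'\<close> by simp
  finally have e: "b * adj b * p = p * (b * adj b * p)" .
  from arg_cong[OF e, of adj] have "p * b * adj b = p * (b * adj b * p)"
    by (simp only: adj_mult adj_adj p mult.assoc)
  with e have "b * adj b * p = p * b * adj b" by (rule trans[OF _ sym])
  then show ?thesis by (simp add: p_def[symmetric] adj_mult p mult.assoc)
qed

theorem reverse_order_law:
  assumes a: "is_pseudoinverse a a'" and b: "is_pseudoinverse b b'"
  shows "is_pseudoinverse (a * b) (b' * a') \<longleftrightarrow>
    adj (a' * a * b * adj b) = a' * a * b * adj b \<and>
    adj (adj a * a * b * b') = adj a * a * b * b'" (is "?rev \<longleftrightarrow> ?h1 \<and> ?h2")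
proof -
  note A = is_pseudoinverseD[OF a] and B = is_pseudoinverseD[OF b]
  note a_adj = is_pseudoinverse_adj[OF a] and b_adj = is_pseudoinverse_adj[OF b]
  \<comment> \<open>The second condition for \<open>(a, b)\<close> is the first one for \<open>(b\<^sup>*, a\<^sup>*)\<close>.\<close>
  have dual: "adj b' * adj b * adj a * adj (adj a) = adj (adj a * a * b * b')"
    by (simp add: adj_mult mult.assoc)
  have h2: "?h2 \<longleftrightarrow> adj (adj b' * adj b * adj a * adj (adj a)) =
      adj b' * adj b * adj a * adj (adj a)"
    unfolding dual by auto
  show ?thesis
  proof
    assume rev: ?rev
    have "is_pseudoinverse (adj b * adj a) (adj a' * adj b')"
      using is_pseudoinverse_adj[OF rev] by (simp add: adj_mult)
    from selfadjoint_of_reverse_order[OF b_adj a_adj this] selfadjoint_of_reverse_order[OF a b rev]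
    show "?h1 \<and> ?h2" unfolding h2 by simp
  next
    assume "?h1 \<and> ?h2"
    then have h: ?h1 "adj (adj b' * adj b * adj a * adj (adj a)) =
      adj b' * adj b * adj a * adj (adj a)" using h2 by auto
    have pq: "a' * a * (b * b') = b * b' * (a' * a)"
      using projections_commute_of_selfadjoint[OF a b h(1)] .
    have left: "adj (b' * (a' * a) * b) = b' * (a' * a) * b"
      using product_selfadjoint_of_selfadjoint[OF a b h(1)] .
    have "adj (adj a' * (adj b' * adj b) * adj a) = adj a' * (adj b' * adj b) * adj a"
      using product_selfadjoint_of_selfadjoint[OF b_adj a_adj h(2)] .
    then have right: "adj (a * (b * b') * a') = a * (b * b') * a'"
      using B(3) by (simp add: adj_mult mult.assoc)
    have "a * b * (b' * a') * (a * b) = a * (b * b' * (a' * a)) * b" by (simp add: mult.assoc)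
    also have "\<dots> = (a * a' * a) * (b * b' * b)" unfolding pq[symmetric] by (simp add: mult.assoc)
    finally have 1: "a * b * (b' * a') * (a * b) = a * b" using A(1) B(1) by simp
    have "b' * a' * (a * b) * (b' * a') = b' * (a' * a * (b * b')) * a'" by (simp add: mult.assoc)
    also have "\<dots> = (b' * b * b') * (a' * a * a')" unfolding pq by (simp add: mult.assoc)
    finally have 2: "b' * a' * (a * b) * (b' * a') = b' * a'" using A(2) B(2) by simp
    show ?rev
      using 1 2 left right by (simp add: is_pseudoinverse_def mult.assoc)
  qed
qed

end


section \<open>Finitely supported matrices\<close>

text \<open>
  Square matrices over one index type, zero outside a finite block. Matrices of any finite
  rectangular shape embed into this ring, and its product agrees with theirs whenever the inner
  dimensions match.
\<close>

typedef 'a fin_matrix = "{f :: 'a \<Rightarrow> 'a \<Rightarrow> complex. finite {(i, j). f i j \<noteq> 0}}"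
  morphisms coeff Abs_fin_matrix
  by (rule exI[of _ "\<lambda>_ _. 0"]) simp

setup_lifting type_definition_fin_matrix

lemma fin_matrix_eqI: "(\<And>i j. coeff x i j = coeff y i j) \<Longrightarrow> x = y"
  by transfer (simp add: fun_eq_iff)

lemma finite_support_carrier:
  obtains S where "finite S" "\<And>i j. coeff x i j \<noteq> 0 \<Longrightarrow> i \<in> S \<and> j \<in> S"
proof
  have fin: "finite {(i, j). coeff x i j \<noteq> 0}" using coeff[of x] by simp
  show "finite (fst ` {(i, j). coeff x i j \<noteq> 0} \<union> snd ` {(i, j). coeff x i j \<noteq> 0})"
    using fin by simp
  show "i \<in> fst ` {(i, j). coeff x i j \<noteq> 0} \<union> snd ` {(i, j). coeff x i j \<noteq> 0} \<and>
      j \<in> fst ` {(i, j). coeff x i j \<noteq> 0} \<union> snd ` {(i, j). coeff x i j \<noteq> 0}"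
    if "coeff x i j \<noteq> 0" for i j
    using that by force
qed

lemma finite_row_support: "finite {k. coeff x i k \<noteq> 0}"
proof -
  obtain S where S: "finite S" "\<And>i j. coeff x i j \<noteq> 0 \<Longrightarrow> i \<in> S \<and> j \<in> S"
    by (rule finite_support_carrier) blast
  then show ?thesis by (intro finite_subset[OF _ S(1)]) auto
qed

instantiation fin_matrix :: (type) proper_star_ring
begin

lift_definition zero_fin_matrix :: "'a fin_matrix" is "\<lambda>_ _. 0" by simp

lift_definition plus_fin_matrix :: "'a fin_matrix \<Rightarrow> 'a fin_matrix \<Rightarrow> 'a fin_matrix"
  is "\<lambda>f g i j. f i j + g i j"
proof -
  fix f g :: "'a \<Rightarrow> 'a \<Rightarrow> complex"
  assume "finite {(i, j). f i j \<noteq> 0}" "finite {(i, j). g i j \<noteq> 0}"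
  from finite_UnI[OF this] show "finite {(i, j). f i j + g i j \<noteq> 0}"
    by (rule finite_subset[rotated]) auto
qed

lift_definition uminus_fin_matrix :: "'a fin_matrix \<Rightarrow> 'a fin_matrix" is "\<lambda>f i j. - f i j"
  by simp

lift_definition minus_fin_matrix :: "'a fin_matrix \<Rightarrow> 'a fin_matrix \<Rightarrow> 'a fin_matrix"
  is "\<lambda>f g i j. f i j - g i j"
proof -
  fix f g :: "'a \<Rightarrow> 'a \<Rightarrow> complex"
  assume "finite {(i, j). f i j \<noteq> 0}" "finite {(i, j). g i j \<noteq> 0}"
  from finite_UnI[OF this] show "finite {(i, j). f i j - g i j \<noteq> 0}"
    by (rule finite_subset[rotated]) auto
qed

lift_definition times_fin_matrix :: "'a fin_matrix \<Rightarrow> 'a fin_matrix \<Rightarrow> 'a fin_matrix"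
  is "\<lambda>f g i j. \<Sum>k | f i k \<noteq> 0. f i k * g k j"
proof -
  fix f g :: "'a \<Rightarrow> 'a \<Rightarrow> complex"
  assume fin: "finite {(i, j). f i j \<noteq> 0}" "finite {(i, j). g i j \<noteq> 0}"
  have "(i, j) \<in> fst ` {(i, j). f i j \<noteq> 0} \<times> snd ` {(i, j). g i j \<noteq> 0}"
    if nz: "(\<Sum>k | f i k \<noteq> 0. f i k * g k j) \<noteq> 0" for i j
  proof -
    obtain k where "f i k * g k j \<noteq> 0"
      using nz by (rule sum.not_neutral_contains_not_neutral)
    then show ?thesis by force
  qed
  then have "{(i, j). (\<Sum>k | f i k \<noteq> 0. f i k * g k j) \<noteq> 0} \<subseteq>
      fst ` {(i, j). f i j \<noteq> 0} \<times> snd ` {(i, j). g i j \<noteq> 0}"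
    by (intro subsetI) (simp only: mem_Collect_eq split_paired_all case_prod_conv)
  then show "finite {(i, j). (\<Sum>k | f i k \<noteq> 0. f i k * g k j) \<noteq> 0}"
    by (rule finite_subset) (intro finite_cartesian_product finite_imageI fin)
qed

lift_definition adj_fin_matrix :: "'a fin_matrix \<Rightarrow> 'a fin_matrix" is "\<lambda>f i j. cnj (f j i)"
proof -
  fix f :: "'a \<Rightarrow> 'a \<Rightarrow> complex"
  assume "finite {(i, j). f i j \<noteq> 0}"
  from finite_imageI[OF this, of prod.swap] show "finite {(i, j). cnj (f j i) \<noteq> 0}"
    by (rule finite_subset[rotated]) force
qed

lemma coeff_simps:
  "coeff 0 i j = 0"
  "coeff (x + y) i j = coeff x i j + coeff y i j"
  "coeff (- x) i j = - coeff x i j"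
  "coeff (x - y) i j = coeff x i j - coeff y i j"
  "coeff (adj x) i j = cnj (coeff x j i)"
  by (transfer, simp)+

text \<open>
  The product is defined as a sum over the support of a row of the left factor. It may be taken
  over any finite set outside of which the summands vanish; a set that does not depend on the row
  is what allows sums to be added and interchanged.
\<close>

lemma coeff_times:
  assumes "finite S" and "\<And>k. k \<notin> S \<Longrightarrow> coeff x i k = 0 \<or> coeff y k j = 0"
  shows "coeff (x * y) i j = (\<Sum>k\<in>S. coeff x i k * coeff y k j)"
proof -
  have "coeff (x * y) i j = (\<Sum>k | coeff x i k \<noteq> 0. coeff x i k * coeff y k j)"
    by transfer simp
  also have "\<dots> = (\<Sum>k\<in>S. coeff x i k * coeff y k j)"
    using assms finite_row_support[of x i] by (intro sum.mono_neutral_cong) auto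
  finally show ?thesis .
qed

instance
proof
  fix x y z :: "'a fin_matrix"
  show "x + y + z = x + (y + z)" "x + y = y + x" "0 + x = x" "- x + x = 0" "x - y = x + - y"
    by (rule fin_matrix_eqI, simp add: coeff_simps)+
  show "adj (adj x) = x" "adj (x + y) = adj x + adj y"
    by (rule fin_matrix_eqI, simp add: coeff_simps)+
  obtain S where S: "finite S" "\<And>i j. coeff x i j \<noteq> 0 \<Longrightarrow> i \<in> S \<and> j \<in> S"
    by (rule finite_support_carrier) blast
  obtain T where T: "finite T" "\<And>i j. coeff y i j \<noteq> 0 \<Longrightarrow> i \<in> T \<and> j \<in> T"
    by (rule finite_support_carrier) blast
  have x_times: "coeff (x * w) i j = (\<Sum>k\<in>S. coeff x i k * coeff w k j)" for w i j
    using S by (intro coeff_times) auto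
  have y_times: "coeff (y * w) i j = (\<Sum>k\<in>T. coeff y i k * coeff w k j)" for w i j
    using T by (intro coeff_times) auto
  have times_y: "coeff (w * y) i j = (\<Sum>k\<in>T. coeff w i k * coeff y k j)" for w i j
    using T by (intro coeff_times) auto
  show "x * y * z = x * (y * z)"
  proof (rule fin_matrix_eqI)
    fix i j
    have "coeff (x * y * z) i j = (\<Sum>l\<in>T. coeff (x * y) i l * coeff z l j)"
      using T by (intro coeff_times) (auto simp: times_y intro!: sum.neutral)
    also have "\<dots> = (\<Sum>l\<in>T. \<Sum>k\<in>S. coeff x i k * coeff y k l * coeff z l j)"
      by (simp add: x_times sum_distrib_right)
    also have "\<dots> = (\<Sum>k\<in>S. \<Sum>l\<in>T. coeff x i k * coeff y k l * coeff z l j)"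
      by (rule sum.swap)
    also have "\<dots> = coeff (x * (y * z)) i j"
      by (simp add: x_times y_times sum_distrib_left mult.assoc)
    finally show "coeff (x * y * z) i j = coeff (x * (y * z)) i j" .
  qed
  show "(x + y) * z = x * z + y * z"
  proof (rule fin_matrix_eqI)
    fix i j
    obtain U where "finite U" "\<And>i j. coeff z i j \<noteq> 0 \<Longrightarrow> i \<in> U \<and> j \<in> U"
      by (rule finite_support_carrier) blast
    then have "coeff (w * z) i j = (\<Sum>k\<in>U. coeff w i k * coeff z k j)" for w
      by (intro coeff_times) auto
    then show "coeff ((x + y) * z) i j = coeff (x * z + y * z) i j"
      by (simp add: coeff_simps sum.distrib distrib_right)
  qed
  show "x * (y + z) = x * y + x * z"
    by (rule fin_matrix_eqI) (simp add: coeff_simps x_times sum.distrib distrib_left)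
  show "adj (x * y) = adj y * adj x"
  proof (rule fin_matrix_eqI)
    fix i j
    have "coeff (adj y * adj x) i j = (\<Sum>k\<in>S. coeff (adj y) i k * coeff (adj x) k j)"
      using S by (intro coeff_times) (auto simp: coeff_simps)
    then show "coeff (adj (x * y)) i j = coeff (adj y * adj x) i j"
      by (simp add: coeff_simps x_times mult.commute)
  qed
  show "x = 0" if "adj x * x = 0"
  proof (rule fin_matrix_eqI)
    fix i j
    have "coeff (adj x * x) j j = (\<Sum>k\<in>S. coeff (adj x) j k * coeff x k j)"
      using S by (intro coeff_times) auto
    then have "(\<Sum>k\<in>S. cnj (coeff x k j) * coeff x k j) = 0"
      using that by (simp add: coeff_simps)
    then have "complex_of_real (\<Sum>k\<in>S. (cmod (coeff x k j))\<^sup>2) = 0"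
      by (simp add: complex_norm_square mult.commute del: of_real_power)
    then have "(\<Sum>k\<in>S. (cmod (coeff x k j))\<^sup>2) = 0"
      by (simp only: of_real_eq_0_iff)
    then have "\<forall>k\<in>S. coeff x k j = 0"
      using S(1) by (subst (asm) sum_nonneg_eq_0_iff) auto
    then show "coeff x i j = coeff 0 i j" using S(2)[of i j] by (auto simp: coeff_simps)
  qed
qed

end


section \<open>Solvability of the normal equations\<close>

text \<open>
  The vector \<open>v\<close> is projected orthogonally onto the span of the columns \<open>a\<^sub>j\<close>, one column at a time:
  if \<open>r\<close> and \<open>s\<close> are the parts of \<open>v\<close> and of the new column that are orthogonal to the earlier
  columns, then \<open>r - t s\<close> with \<open>t = \<langle>s, r\<rangle> / \<langle>s, s\<rangle>\<close> is orthogonal to the new column as well.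
\<close>

lemma normal_equations_solvable:
  fixes a :: "'i \<Rightarrow> 'j \<Rightarrow> complex"
  assumes "finite I" and "finite J"
  shows "\<exists>x. \<forall>j\<in>J. (\<Sum>i\<in>I. cnj (a i j) * (v i - (\<Sum>k\<in>J. a i k * x k))) = 0"
  using assms(2)
proof (induction J arbitrary: v rule: finite_induct)
  case empty
  show ?case by simp
next
  case (insert l J)
  obtain x where x: "\<And>j. j \<in> J \<Longrightarrow> (\<Sum>i\<in>I. cnj (a i j) * (v i - (\<Sum>k\<in>J. a i k * x k))) = 0"
    using insert.IH[of v] by blast
  obtain y where y: "\<And>j. j \<in> J \<Longrightarrow> (\<Sum>i\<in>I. cnj (a i j) * (a i l - (\<Sum>k\<in>J. a i k * y k))) = 0"
    using insert.IH[of "\<lambda>i. a i l"] by blast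
  define r where "r i = v i - (\<Sum>k\<in>J. a i k * x k)" for i
  define s where "s i = a i l - (\<Sum>k\<in>J. a i k * y k)" for i
  define n where "n = (\<Sum>i\<in>I. cnj (s i) * s i)"
  \<comment> \<open>If \<open>n = 0\<close>, the new column depends on the earlier ones and gets the coefficient 0.\<close>
  define t where "t = (if n = 0 then 0 else (\<Sum>i\<in>I. cnj (s i) * r i) / n)"
  define x' where "x' j = (if j = l then t else x j - t * y j)" for j
  have residual: "v i - (\<Sum>k\<in>insert l J. a i k * x' k) = r i - t * s i" for i
  proof -
    have "(\<Sum>k\<in>J. a i k * x' k) = (\<Sum>k\<in>J. a i k * x k - t * (a i k * y k))"
      using insert.hyps by (intro sum.cong) (auto simp: x'_def algebra_simps)
    then show ?thesis
      using insert.hyps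
      by (simp add: r_def s_def x'_def sum_subtractf sum_distrib_left algebra_simps)
  qed
  have ortho: "(\<Sum>i\<in>I. cnj (a i j) * (r i - t * s i)) = 0" if "j \<in> J" for j
  proof -
    have "(\<Sum>i\<in>I. cnj (a i j) * (r i - t * s i)) =
        (\<Sum>i\<in>I. cnj (a i j) * r i) - t * (\<Sum>i\<in>I. cnj (a i j) * s i)"
      by (simp add: sum_subtractf sum_distrib_left algebra_simps)
    then show ?thesis using x[OF that] y[OF that] by (simp add: r_def s_def)
  qed
  have ortho_s: "(\<Sum>i\<in>I. cnj (s i) * (r i - t * s i)) = 0"
  proof (cases "n = 0")
    case True
    then have "complex_of_real (\<Sum>i\<in>I. (cmod (s i))\<^sup>2) = 0"
      by (simp add: n_def complex_norm_square mult.commute del: of_real_power)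
    then have "(\<Sum>i\<in>I. (cmod (s i))\<^sup>2) = 0"
      by (simp only: of_real_eq_0_iff)
    then have "\<forall>i\<in>I. s i = 0"
      using assms(1) by (subst (asm) sum_nonneg_eq_0_iff) auto
    then show ?thesis by simp
  next
    case False
    have "(\<Sum>i\<in>I. cnj (s i) * (r i - t * s i)) = (\<Sum>i\<in>I. cnj (s i) * r i) - t * n"
      by (simp add: n_def sum_subtractf sum_distrib_left algebra_simps)
    then show ?thesis using False by (simp add: t_def)
  qed
  have ortho_l: "(\<Sum>i\<in>I. cnj (a i l) * (r i - t * s i)) = 0"
  proof -
    have "cnj (a i l) = cnj (s i) + (\<Sum>j\<in>J. cnj (y j) * cnj (a i j))" for i
      by (simp add: s_def mult.commute)
    then have "(\<Sum>i\<in>I. cnj (a i l) * (r i - t * s i)) =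
        (\<Sum>i\<in>I. cnj (s i) * (r i - t * s i)) +
        (\<Sum>i\<in>I. \<Sum>j\<in>J. cnj (y j) * (cnj (a i j) * (r i - t * s i)))"
      by (simp add: distrib_right sum.distrib sum_distrib_right mult.assoc)
    also have "(\<Sum>i\<in>I. \<Sum>j\<in>J. cnj (y j) * (cnj (a i j) * (r i - t * s i))) =
        (\<Sum>j\<in>J. cnj (y j) * (\<Sum>i\<in>I. cnj (a i j) * (r i - t * s i)))"
      by (subst sum.swap) (simp add: sum_distrib_left)
    finally show ?thesis using ortho ortho_s by simp
  qed
  have "\<forall>j\<in>insert l J. (\<Sum>i\<in>I. cnj (a i j) * (v i - (\<Sum>k\<in>insert l J. a i k * x' k))) = 0"
    unfolding residual using ortho ortho_l by blast
  then show ?case by blast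
qed


section \<open>Tensors as matrices\<close>

lemma finite_multi_indices: "finite (multi_indices ds)"
proof -
  have "multi_indices ds \<subseteq> {xs. set xs \<subseteq> {..<Max (set ds)} \<and> length xs = length ds}"
  proof
    fix xs assume "xs \<in> multi_indices ds"
    then have len: "length xs = length ds" and lt: "\<And>k. k < length ds \<Longrightarrow> xs ! k < ds ! k"
      by (auto simp: multi_indices_def list_all2_conv_all_nth)
    have "x < Max (set ds)" if "x \<in> set xs" for x
      using that lt len by (auto simp: in_set_conv_nth Max_gr_iff)
        (metis List.finite_set Max_ge nth_mem order_less_le_trans)
    with len show "xs \<in> {xs. set xs \<subseteq> {..<Max (set ds)} \<and> length xs = length ds}" by auto
  qed
  then show ?thesis by (rule finite_subset) (simp add: finite_lists_length_eq)
qed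

lift_definition matricize :: "nat list \<Rightarrow> nat list \<Rightarrow> tensor \<Rightarrow> nat list fin_matrix" is
  "\<lambda>Is Js A i j. if i \<in> multi_indices Is \<and> j \<in> multi_indices Js then entry A (i @ j) else 0"
  by (rule finite_subset[OF _ finite_cartesian_product[OF finite_multi_indices finite_multi_indices]])
    (auto split: if_splits)

lemma coeff_matricize:
  "coeff (matricize Is Js A) i j =
    (if i \<in> multi_indices Is \<and> j \<in> multi_indices Js then entry A (i @ j) else 0)"
  by (simp add: matricize.rep_eq)

lemma multi_indices_appendE:
  assumes "l \<in> multi_indices (Is @ Js)"
  obtains i j where "l = i @ j" "i \<in> multi_indices Is" "j \<in> multi_indices Js"
  using assms that unfolding multi_indices_def mem_Collect_eq list_all2_append2 by blast

lemma matricize_eq_iff: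
  assumes "A \<in> tensors (Is @ Js)" "B \<in> tensors (Is @ Js)"
  shows "matricize Is Js A = matricize Is Js B \<longleftrightarrow> A = B"
proof
  assume eq: "matricize Is Js A = matricize Is Js B"
  show "A = B"
  proof (rule tensor_eqI)
    show "dims A = dims B" using assms by (simp add: tensors_def)
    fix l assume "l \<in> multi_indices (dims A)"
    then obtain i j where l: "l = i @ j" "i \<in> multi_indices Is" "j \<in> multi_indices Js"
      using assms(1) by (auto simp: tensors_def elim: multi_indices_appendE)
    then show "entry A l = entry B l"
      using arg_cong[OF eq, of "\<lambda>M. coeff M i j"] by (simp add: coeff_matricize)
  qed
qed simp

lemma matricize_einstein_prod:
  assumes "A \<in> tensors (Is @ Ks)" "B \<in> tensors (Ks @ Js)" "length Ks = N"
  shows "matricize Is Js (A \<star>\<^bsub>N\<^esub> B) = matricize Is Ks A * matricize Ks Js B"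
proof (rule fin_matrix_eqI)
  fix i j
  have "coeff (matricize Is Ks A * matricize Ks Js B) i j =
      (\<Sum>k\<in>multi_indices Ks. coeff (matricize Is Ks A) i k * coeff (matricize Ks Js B) k j)"
    by (intro coeff_times finite_multi_indices) (auto simp: coeff_matricize)
  then show "coeff (matricize Is Js (A \<star>\<^bsub>N\<^esub> B)) i j =
      coeff (matricize Is Ks A * matricize Ks Js B) i j"
    by (auto simp: coeff_matricize entry_einstein_prod[OF assms])
qed

lemma matricize_conj_transpose:
  assumes "A \<in> tensors (Is @ Js)" "length Is = N"
  shows "matricize Js Is (conj_transpose N A) = adj (matricize Is Js A)"
  by (rule fin_matrix_eqI)
    (auto simp: coeff_matricize coeff_simps entry_conj_transpose[OF assms])

lemma hermitian_iff_matricize: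
  assumes "C \<in> tensors (Is @ Is)" "length Is = N"
  shows "hermitian N C \<longleftrightarrow> adj (matricize Is Is C) = matricize Is Is C"
  unfolding hermitian_def matricize_conj_transpose[OF assms, symmetric]
    matricize_eq_iff[OF conj_transpose_in_tensors[OF assms] assms(1)]
  by (rule eq_commute)

text \<open>
  The block shape has to be kept on the right: \<open>matricize Js Is\<close> reads only the entries in that
  block, so it determines \<open>X\<close> only among the tensors of shape \<open>Js @ Is\<close>.
\<close>

lemma is_mp_inverse_iff_matricize:
  assumes "length Is = N" "length Js = N" and A: "A \<in> tensors (Is @ Js)"
  shows "is_mp_inverse N A X \<longleftrightarrow>
    X \<in> tensors (Js @ Is) \<and> is_pseudoinverse (matricize Is Js A) (matricize Js Is X)"
proof (cases "X \<in> tensors (Js @ Is)")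
  case X: True
  note AX = einstein_prod_in_tensors[OF A X assms(2)]
    and XA = einstein_prod_in_tensors[OF X A assms(1)]
  note AXA = einstein_prod_in_tensors[OF AX A assms(1)]
    and XAX = einstein_prod_in_tensors[OF XA X assms(2)]
  note mAX = matricize_einstein_prod[OF A X assms(2)]
    and mXA = matricize_einstein_prod[OF X A assms(1)]
  have "A \<star>\<^bsub>N\<^esub> X \<star>\<^bsub>N\<^esub> A = A \<longleftrightarrow>
      matricize Is Js A * matricize Js Is X * matricize Is Js A = matricize Is Js A"
    unfolding matricize_eq_iff[OF AXA A, symmetric] matricize_einstein_prod[OF AX A assms(1)] mAX ..
  moreover have "X \<star>\<^bsub>N\<^esub> A \<star>\<^bsub>N\<^esub> X = X \<longleftrightarrow>
      matricize Js Is X * matricize Is Js A * matricize Js Is X = matricize Js Is X"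
    unfolding matricize_eq_iff[OF XAX X, symmetric] matricize_einstein_prod[OF XA X assms(2)] mXA ..
  moreover have "conj_transpose N (A \<star>\<^bsub>N\<^esub> X) = A \<star>\<^bsub>N\<^esub> X \<longleftrightarrow>
      adj (matricize Is Js A * matricize Js Is X) = matricize Is Js A * matricize Js Is X"
    using hermitian_iff_matricize[OF AX assms(1)]
    unfolding hermitian_def mAX by (simp only: eq_commute[of "A \<star>\<^bsub>N\<^esub> X"])
  moreover have "conj_transpose N (X \<star>\<^bsub>N\<^esub> A) = X \<star>\<^bsub>N\<^esub> A \<longleftrightarrow>
      adj (matricize Js Is X * matricize Is Js A) = matricize Js Is X * matricize Is Js A"
    using hermitian_iff_matricize[OF XA assms(2)]
    unfolding hermitian_def mXA by (simp only: eq_commute[of "X \<star>\<^bsub>N\<^esub> A"])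
  moreover have "drop N (dims A) @ take N (dims A) = Js @ Is"
    using A assms by (auto simp: tensors_def)
  ultimately show ?thesis using X by (simp add: is_mp_inverse_def is_pseudoinverse_def)
next
  case False
  then show ?thesis using A assms by (auto simp: is_mp_inverse_def tensors_def)
qed

text \<open>
  Column \<open>i'\<close> of the solution comes from projecting the unit vector with index \<open>i'\<close> onto the
  column space of \<open>A\<close>.
\<close>

lemma normal_equations_solvable_tensor:
  assumes "A \<in> tensors (Is @ Js)"
  obtains X where "X \<in> tensors (Js @ Is)"
    "adj (matricize Is Js A) * matricize Is Js A * matricize Js Is X = adj (matricize Is Js A)"
proof -
  let ?I = "multi_indices Is" and ?J = "multi_indices Js"
  define a where "a = coeff (matricize Is Js A)"
  have "\<forall>i'. \<exists>x. \<forall>j\<in>?J.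
      (\<Sum>i\<in>?I. cnj (a i j) * ((if i = i' then 1 else 0) - (\<Sum>k\<in>?J. a i k * x k))) = 0"
    by (intro allI normal_equations_solvable finite_multi_indices)
  from choice[OF this] obtain x where x: "\<And>i' j. j \<in> ?J \<Longrightarrow>
      (\<Sum>i\<in>?I. cnj (a i j) * ((if i = i' then 1 else 0) - (\<Sum>k\<in>?J. a i k * x i' k))) = 0"
    by blast
  define X where "X = mk_tensor (Js @ Is) (\<lambda>l. x (drop (length Js) l) (take (length Js) l))"
  have entry_X: "coeff (matricize Js Is X) j i = (if j \<in> ?J \<and> i \<in> ?I then x i j else 0)" for i j
  proof (cases "j \<in> ?J \<and> i \<in> ?I")
    case True
    then have "length j = length Js" by (auto simp: multi_indices_def dest: list_all2_lengthD)
    with True show ?thesis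
      by (simp add: coeff_matricize X_def append_in_multi_indices)
  qed (auto simp: coeff_matricize)
  have a0: "a i j = 0" if "i \<notin> ?I \<or> j \<notin> ?J" for i j
    using that by (auto simp: a_def coeff_matricize)
  have "adj (matricize Is Js A) * (matricize Is Js A * matricize Js Is X) = adj (matricize Is Js A)"
  proof (rule fin_matrix_eqI)
    fix j i'
    have AX: "coeff (matricize Is Js A * matricize Js Is X) i i' =
        (\<Sum>k\<in>?J. a i k * coeff (matricize Js Is X) k i')" for i
      unfolding a_def by (intro coeff_times finite_multi_indices) (auto simp: coeff_matricize)
    have "coeff (adj (matricize Is Js A) * (matricize Is Js A * matricize Js Is X)) j i' =
        (\<Sum>i\<in>?I. coeff (adj (matricize Is Js A)) j i *
          coeff (matricize Is Js A * matricize Js Is X) i i')"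
      by (intro coeff_times finite_multi_indices) (auto simp: coeff_matricize coeff_simps)
    then have lhs: "coeff (adj (matricize Is Js A) * (matricize Is Js A * matricize Js Is X)) j i' =
        (\<Sum>i\<in>?I. cnj (a i j) * (\<Sum>k\<in>?J. a i k * coeff (matricize Js Is X) k i'))"
      by (simp add: AX coeff_simps a_def)
    show "coeff (adj (matricize Is Js A) * (matricize Is Js A * matricize Js Is X)) j i' =
        coeff (adj (matricize Is Js A)) j i'"
    proof (cases "j \<in> ?J \<and> i' \<in> ?I")
      case True
      have "(\<Sum>i\<in>?I. cnj (a i j) * (if i = i' then 1 else 0)) -
          (\<Sum>i\<in>?I. cnj (a i j) * (\<Sum>k\<in>?J. a i k * x i' k)) = 0"
        using x[of j i'] True by (simp add: right_diff_distrib sum_subtractf)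
      moreover have "(\<Sum>i\<in>?I. cnj (a i j) * (if i = i' then 1 else 0)) = cnj (a i' j)"
        using True finite_multi_indices by (simp add: if_distrib cong: if_cong)
      ultimately show ?thesis
        using True unfolding lhs by (simp add: entry_X coeff_simps a_def)
    next
      case False
      then show ?thesis unfolding lhs by (auto simp: entry_X a0 coeff_simps a_def[symmetric])
    qed
  qed
  moreover have "X \<in> tensors (Js @ Is)" by (simp add: X_def tensors_def)
  ultimately show thesis using that by (simp add: mult.assoc)
qed

text \<open>
  The pseudoinverse \<open>z\<^sup>* a x\<close> built from solutions of the two normal equations is again the matrix
  of a tensor of the required shape, because each factor is.
\<close>

lemma mp_inverse_matricize:
  assumes len: "length Is = N" "length Js = N" and A: "A \<in> tensors (Is @ Js)"
  shows mp_inverse_in_tensors: "mp_inverse N A \<in> tensors (Js @ Is)"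
    and is_pseudoinverse_mp_inverse:
      "is_pseudoinverse (matricize Is Js A) (matricize Js Is (mp_inverse N A))"
proof -
  note A' = conj_transpose_in_tensors[OF A len(1)]
  obtain X where X: "X \<in> tensors (Js @ Is)"
    "adj (matricize Is Js A) * matricize Is Js A * matricize Js Is X = adj (matricize Is Js A)"
    using normal_equations_solvable_tensor[OF A] .
  obtain Z where Z: "Z \<in> tensors (Is @ Js)"
    "matricize Is Js A * adj (matricize Is Js A) * matricize Is Js Z = matricize Is Js A"
    using normal_equations_solvable_tensor[OF A']
    by (auto simp: matricize_conj_transpose[OF A len(1)])
  define Y where "Y = conj_transpose N Z \<star>\<^bsub>N\<^esub> A \<star>\<^bsub>N\<^esub> X"
  note Z' = conj_transpose_in_tensors[OF Z(1) len(1)]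
  note ZA = einstein_prod_in_tensors[OF Z' A len(1)]
  have Y: "Y \<in> tensors (Js @ Is)"
    unfolding Y_def by (rule einstein_prod_in_tensors[OF ZA X(1) len(2)])
  have "matricize Js Is Y = adj (matricize Is Js Z) * matricize Is Js A * matricize Js Is X"
    by (simp add: Y_def matricize_einstein_prod[OF ZA X(1) len(2)]
        matricize_einstein_prod[OF Z' A len(1)] matricize_conj_transpose[OF Z(1) len(1)])
  then have "is_pseudoinverse (matricize Is Js A) (matricize Js Is Y)"
    using is_pseudoinverse_of_normal_equations[OF X(2) Z(2)] by simp
  with Y have "is_mp_inverse N A Y" by (simp add: is_mp_inverse_iff_matricize[OF len A])
  moreover have "X' = Y" if "is_mp_inverse N A X'" for X'
    using that calculation is_pseudoinverse_unique matricize_eq_iff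
    unfolding is_mp_inverse_iff_matricize[OF len A] by blast
  ultimately have "is_mp_inverse N A (mp_inverse N A)"
    unfolding mp_inverse_def by (rule theI)
  then show "mp_inverse N A \<in> tensors (Js @ Is)"
    "is_pseudoinverse (matricize Is Js A) (matricize Js Is (mp_inverse N A))"
    by (simp_all add: is_mp_inverse_iff_matricize[OF len A])
qed

lemma mp_inverse_eq_iff_matricize:
  assumes len: "length Is = N" "length Js = N"
    and A: "A \<in> tensors (Is @ Js)" and X: "X \<in> tensors (Js @ Is)"
  shows "mp_inverse N A = X \<longleftrightarrow> is_pseudoinverse (matricize Is Js A) (matricize Js Is X)"
  using mp_inverse_matricize[OF len A] is_pseudoinverse_unique matricize_eq_iff[OF _ X] by blast


section \<open>The reverse order law for tensors\<close>

theorem theorem3p26: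
  fixes A B :: tensor and Is Js :: "nat list" and N :: nat
  assumes "length Is = N" and "length Js = N"
    and "A \<in> tensors (Is @ Js)" and "B \<in> tensors (Js @ Is)"
  shows "mp_inverse N (A \<star>\<^bsub>N\<^esub> B) = mp_inverse N B \<star>\<^bsub>N\<^esub> mp_inverse N A \<longleftrightarrow>
    hermitian N (mp_inverse N A \<star>\<^bsub>N\<^esub> A \<star>\<^bsub>N\<^esub> B \<star>\<^bsub>N\<^esub> conj_transpose N B) \<and>
    hermitian N (conj_transpose N A \<star>\<^bsub>N\<^esub> A \<star>\<^bsub>N\<^esub> B \<star>\<^bsub>N\<^esub> mp_inverse N B)"
proof -
  note I = assms(1) and J = assms(2) and A = assms(3) and B = assms(4)
  note A' = mp_inverse_in_tensors[OF I J A] and B' = mp_inverse_in_tensors[OF J I B]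
  note As = conj_transpose_in_tensors[OF A I] and Bs = conj_transpose_in_tensors[OF B J]
  note AB = einstein_prod_in_tensors[OF A B J] and B'A' = einstein_prod_in_tensors[OF B' A' J]
  note A'A = einstein_prod_in_tensors[OF A' A I] and AsA = einstein_prod_in_tensors[OF As A I]
  note A'AB = einstein_prod_in_tensors[OF A'A B J] and AsAB = einstein_prod_in_tensors[OF AsA B J]
  note A'ABBs = einstein_prod_in_tensors[OF A'AB Bs I]
    and AsABB' = einstein_prod_in_tensors[OF AsAB B' I]
  note mat = matricize_einstein_prod[OF A B J] matricize_einstein_prod[OF B' A' J]
    matricize_einstein_prod[OF A' A I] matricize_einstein_prod[OF As A I]
    matricize_einstein_prod[OF A'A B J] matricize_einstein_prod[OF AsA B J]
    matricize_einstein_prod[OF A'AB Bs I] matricize_einstein_prod[OF AsAB B' I]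
    matricize_conj_transpose[OF A I] matricize_conj_transpose[OF B J]
  show ?thesis
    unfolding mp_inverse_eq_iff_matricize[OF I I AB B'A']
      hermitian_iff_matricize[OF A'ABBs J] hermitian_iff_matricize[OF AsABB' J] mat
    by (rule reverse_order_law[OF is_pseudoinverse_mp_inverse[OF I J A]
          is_pseudoinverse_mp_inverse[OF J I B]])
qed

end
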